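(* If $\mathbf{M}$ is a finite cyclic monoid, then $\mathbf{R}_{\mathbf{M}}$ is the reduct of a residuated lattice.
   Context: A residuated lattice is an algebra $(R,\wedge,\vee,\cdot,\backslash,/,1)$ such that $(R,\wedge,\vee)$ is a lattice, $(R,\cdot,1)$ is a monoid, and $xy\le z \iff y\le x\backslash z \iff x\le z/y$ for all $x,y,z$. Let $\mathbf{M}$ be a finite cyclic monoid generated by $a$. Its index is the smallest natural number $r$ such that $a^r=a^{r+s}$ for some positive integer $s$, and the smallest such $s$ is its period. So $M=\{1,a,\dots,a^r,\dots,a^{r+s-1}\}$ has $r+s$ elements. $\mathbf{R}_{\mathbf{M}}$ is the lattice-ordered monoid on $R=M\cup\{\bot,\top\}$ ($\bot\ne\top$ new elements) whose multiplication extends that of $\mathbf{M}$ by $\bot x=x\bot=\bot$ for all $x\in R$ and $\top x=x\top=\top$ for all $x\neq\bot$, and whose order is given by $\bot\le x\le\top$ for all $x\in R$ and, for $0\le i,j\le r+s-1$, $a^i\le a^j$ if and only if $j=i+ns$ for some $n\in\mathbb{N}$ (with $0\in\mathbb{N}$). *)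

theory Defs
  imports "HOL-Algebra.Group"
begin

section \<open>Ordered monoids and residuated lattices\<close>

record 'a ordered_monoid = "'a monoid" +
  mle :: "'a \<Rightarrow> 'a \<Rightarrow> bool" (infixl \<open>\<preceq>\<index>\<close> 50)

definition order_of :: "('a, 'b) ordered_monoid_scheme \<Rightarrow> 'a gorder"
  where "order_of L = \<lparr>carrier = carrier L, eq = (=), le = mle L\<rparr>"

text \<open>
  \<open>ldiv R x z\<close> is $x \backslash z$ and \<open>rdiv R z y\<close> is $z / y$. The lattice is given by its
  order, as everywhere in HOL-Algebra; the operations $\wedge$ and $\vee$ are
  \<open>meet (order_of R)\<close> and \<open>join (order_of R)\<close>.
\<close>

record 'a residuated_structure = "'a ordered_monoid" +
  ldiv :: "'a \<Rightarrow> 'a \<Rightarrow> 'a"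
  rdiv :: "'a \<Rightarrow> 'a \<Rightarrow> 'a"

locale residuated_lattice = monoid R + order: lattice "order_of R"
  for R (structure) +
  assumes ldiv_closed: "\<lbrakk>x \<in> carrier R; z \<in> carrier R\<rbrakk> \<Longrightarrow> ldiv R x z \<in> carrier R"
    and rdiv_closed: "\<lbrakk>z \<in> carrier R; y \<in> carrier R\<rbrakk> \<Longrightarrow> rdiv R z y \<in> carrier R"
    and ldiv_residual: "\<lbrakk>x \<in> carrier R; y \<in> carrier R; z \<in> carrier R\<rbrakk>
          \<Longrightarrow> x \<otimes> y \<preceq> z \<longleftrightarrow> y \<preceq> ldiv R x z"
    and rdiv_residual: "\<lbrakk>x \<in> carrier R; y \<in> carrier R; z \<in> carrier R\<rbrakk>
          \<Longrightarrow> x \<otimes> y \<preceq> z \<longleftrightarrow> x \<preceq> rdiv R z y"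

text \<open>
  Forgetting the two divisions of \<open>A\<close> leaves exactly \<open>L\<close>: same carrier, multiplication, unit
  and order (hence the same meets and joins).
\<close>

definition is_reduct_of ::
    "'a ordered_monoid \<Rightarrow> 'a residuated_structure \<Rightarrow> bool"
  where "is_reduct_of L A \<longleftrightarrow> L = ordered_monoid.truncate A"


section \<open>Finite cyclic monoids\<close>

locale finite_cyclic_monoid = monoid M for M (structure) and a +
  assumes generator_closed: "a \<in> carrier M"
    and generated: "carrier M = range (\<lambda>n::nat. a [^] n)"
    and finite_carrier: "finite (carrier M)"

definition cyclic_index :: "('a, 'b) monoid_scheme \<Rightarrow> 'a \<Rightarrow> nat"
  where "cyclic_index M a = (LEAST r. \<exists>s>0. a [^]\<^bsub>M\<^esub> r = a [^]\<^bsub>M\<^esub> (r + s))"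

definition cyclic_period :: "('a, 'b) monoid_scheme \<Rightarrow> 'a \<Rightarrow> nat"
  where "cyclic_period M a =
    (LEAST s. s > 0 \<and> a [^]\<^bsub>M\<^esub> cyclic_index M a = a [^]\<^bsub>M\<^esub> (cyclic_index M a + s))"


section \<open>The lattice-ordered monoid of a finite cyclic monoid\<close>

datatype 'a adjoined = Bot | Elem 'a | Top

fun adjoined_mult ::
    "('a, 'b) monoid_scheme \<Rightarrow> 'a adjoined \<Rightarrow> 'a adjoined \<Rightarrow> 'a adjoined"
  where
    "adjoined_mult M Bot y = Bot"
  | "adjoined_mult M x Bot = Bot"
  | "adjoined_mult M Top y = Top"
  | "adjoined_mult M x Top = Top"
  | "adjoined_mult M (Elem x) (Elem y) = Elem (x \<otimes>\<^bsub>M\<^esub> y)"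

text \<open>Below index plus period, every element of \<open>M\<close> has exactly one exponent.\<close>

definition power_le :: "('a, 'b) monoid_scheme \<Rightarrow> 'a \<Rightarrow> 'a \<Rightarrow> 'a \<Rightarrow> bool"
  where "power_le M a x y \<longleftrightarrow>
    (\<exists>i j n. i < cyclic_index M a + cyclic_period M a \<and>
             j < cyclic_index M a + cyclic_period M a \<and>
             x = a [^]\<^bsub>M\<^esub> i \<and> y = a [^]\<^bsub>M\<^esub> j \<and> j = i + n * cyclic_period M a)"

fun adjoined_le ::
    "('a, 'b) monoid_scheme \<Rightarrow> 'a \<Rightarrow> 'a adjoined \<Rightarrow> 'a adjoined \<Rightarrow> bool"
  where
    "adjoined_le M a Bot y = True"
  | "adjoined_le M a x Top = True"
  | "adjoined_le M a (Elem x) (Elem y) = power_le M a x y"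
  | "adjoined_le M a x y = False"

definition R_of :: "('a, 'b) monoid_scheme \<Rightarrow> 'a \<Rightarrow> 'a adjoined ordered_monoid"
  where "R_of M a =
    \<lparr>carrier = Elem ` carrier M \<union> {Bot, Top},
     mult = adjoined_mult M,
     one = Elem \<one>\<^bsub>M\<^esub>,
     mle = adjoined_le M a\<rparr>"

end

theory Submission
  imports Defs
begin

text \<open>
  For \<open>x\<close>, \<open>y\<close> in \<open>M\<close> the order reads: \<open>y = x \<otimes> a [^] (n * s)\<close> for some \<open>n\<close>, where \<open>s\<close> is the
  period. In this form reflexivity, transitivity and compatibility with multiplication are
  immediate, and antisymmetry holds because \<open>x = x \<otimes> a [^] (k * s)\<close> with \<open>k > 0\<close> forces \<open>x\<close> into
  the cycle of \<open>M\<close>, where multiplication by \<open>a [^] s\<close> is the identity.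

  The decisive fact is that the exponent of an element is determined modulo \<open>s\<close>, and that
  comparability means equality of these residues. So \<open>M\<close> is a disjoint union of chains, one for
  each residue that occurs, and adding two bounds gives a lattice. It also makes residuals exist
  without any computation: if \<open>x \<otimes> y \<preceq> z\<close> and \<open>x \<otimes> y' \<preceq> z\<close>, then \<open>y\<close> and \<open>y'\<close> have the same residue,
  so the solutions \<open>y\<close> of \<open>x \<otimes> y \<preceq> z\<close> in \<open>M\<close> form a finite chain. If it is empty, the residual is
  the bottom; otherwise it is the greatest element of the chain, since by monotonicity everything
  in \<open>M\<close> below that element is a solution. When \<open>x\<close> or \<open>z\<close> is one of the new bounds, the
  residual is one of the bounds as well. Commutativity turns left residuals into right ones.
\<close>

context finite_cyclic_monoid
begin

section \<open>Exponents in a finite cyclic monoid\<close>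

abbreviation r :: nat where "r \<equiv> cyclic_index M a"
abbreviation s :: nat where "s \<equiv> cyclic_period M a"

lemma power_closed [simp]: "a [^] (n::nat) \<in> carrier M"
  by (simp add: generator_closed)

lemma power_mult: "a [^] (m::nat) \<otimes> a [^] (n::nat) = a [^] (m + n)"
  by (simp add: generator_closed nat_pow_mult)

lemma carrierE:
  assumes "x \<in> carrier M"
  obtains n :: nat where "x = a [^] n"
  using assms by (auto simp: generated)

lemma power_cong_add: "a [^] (m::nat) = a [^] (n::nat) \<Longrightarrow> a [^] (m + k) = a [^] (n + k)"
  by (metis power_mult)

lemma mult_comm: "x \<in> carrier M \<Longrightarrow> y \<in> carrier M \<Longrightarrow> x \<otimes> y = y \<otimes> x"
  by (elim carrierE) (simp add: power_mult add.commute)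

lemma index_exists: "\<exists>i. \<exists>d>0. a [^] i = a [^] (i + d::nat)"
proof -
  have "\<not> inj (\<lambda>n::nat. a [^] n)"
    using finite_carrier generated finite_imageD infinite_UNIV_nat by metis
  then obtain i j :: nat where "i < j" "a [^] i = a [^] j"
    by (metis (mono_tags, lifting) injI linorder_neqE_nat)
  then show ?thesis
    by (intro exI[of _ i] exI[of _ "j - i"]) auto
qed

lemma index_period: "s > 0" "a [^] (r + s) = a [^] r"
proof -
  have "\<exists>d>0. a [^] r = a [^] (r + d)"
    unfolding cyclic_index_def by (rule LeastI_ex[OF index_exists])
  from LeastI_ex[OF this] show "s > 0" "a [^] (r + s) = a [^] r"
    by (auto simp: cyclic_period_def)
qed

lemma index_le: "0 < d \<Longrightarrow> a [^] i = a [^] (i + d) \<Longrightarrow> r \<le> i"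
  unfolding cyclic_index_def by (rule Least_le) blast

lemma period_le: "0 < d \<Longrightarrow> a [^] (r + d) = a [^] r \<Longrightarrow> s \<le> d"
  unfolding cyclic_period_def by (rule Least_le) simp

lemma power_add_period:
  assumes "r \<le> i" shows "a [^] (i + n * s) = a [^] i"
proof (induction n)
  case (Suc n)
  have "a [^] (r + s + (i - r + n * s)) = a [^] (r + (i - r + n * s))"
    using index_period(2) by (rule power_cong_add)
  with Suc assms show ?case by (simp add: ac_simps)
qed simp

text \<open>
  A repetition can be transported along the cycle to \<open>a [^] r\<close>, where minimality of the period
  applies to the remainder of the shift.
\<close>

lemma period_dvd:
  assumes eq: "a [^] i = a [^] (i + d)"
  shows "s dvd d"
proof (cases "d = 0")
  case False
  with eq have "r \<le> i" by (auto intro: index_le)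
  have "i \<le> r + i * s"
    using index_period(1) by (cases s) auto
  \<comment> \<open>Shifting by \<open>t\<close> takes the exponent \<open>i\<close> to a full multiple of \<open>s\<close> beyond \<open>r\<close>.\<close>
  define t where "t = r + i * s - i"
  have t: "i + t = r + i * s"
    using \<open>i \<le> r + i * s\<close> by (simp add: t_def)
  have "a [^] r = a [^] (i + t)"
    by (simp add: t power_add_period)
  also have "\<dots> = a [^] (i + d + t)"
    using eq by (rule power_cong_add)
  also have "i + d + t = r + d + i * s"
    using t by simp
  also have "a [^] \<dots> = a [^] (r + d)"
    by (simp add: power_add_period)
  also have "r + d = r + d mod s + (d div s) * s"
    by (simp only: add.assoc mod_div_mult_eq)
  also have "a [^] \<dots> = a [^] (r + d mod s)"
    by (rule power_add_period) simp
  finally have "a [^] (r + d mod s) = a [^] r" ..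
  with period_le[of "d mod s"] index_period(1) show ?thesis
    by (meson dvd_eq_mod_eq_0 mod_less_divisor neq0_conv not_le)
qed simp

lemma exponent_mod:
  assumes "a [^] (i::nat) = a [^] (j::nat)"
  shows "i mod s = j mod s"
proof -
  have *: "i mod s = j mod s" if "i \<le> j" "a [^] i = a [^] j" for i j :: nat
    using period_dvd[of i "j - i"] that mod_eq_dvd_iff_nat[of i j s] by auto
  show ?thesis
    using *[of i j] *[of j i] assms by (metis linear)
qed

lemma exponent_less:
  assumes "x \<in> carrier M"
  obtains i where "i < r + s" "x = a [^] i"
proof -
  have ex: "\<exists>i::nat. x = a [^] i"
    using assms by (auto elim: carrierE)
  define i where "i = (LEAST i::nat. x = a [^] i)"
  have x: "x = a [^] i"
    unfolding i_def by (rule LeastI_ex[OF ex])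
  have "i < r + s"
  proof (rule ccontr)
    assume "\<not> i < r + s"
    then have "a [^] (i - s) = x"
      using power_add_period[of "i - s" 1] x by simp
    then have "i \<le> i - s"
      unfolding i_def by (intro Least_le) simp
    then show False
      using index_period(1) \<open>\<not> i < r + s\<close> by simp
  qed
  with x that show thesis by blast
qed


section \<open>The order on the cyclic monoid\<close>

abbreviation le :: "'a \<Rightarrow> 'a \<Rightarrow> bool" (infix \<open>\<lesssim>\<close> 50)
  where "x \<lesssim> y \<equiv> power_le M a x y"

lemma shift_antisym:
  assumes "y = x \<otimes> a [^] (n * s)" "x = y \<otimes> a [^] (m * s)" "x \<in> carrier M"
  shows "x = y"
proof -
  obtain i :: nat where x: "x = a [^] i"
    using assms(3) by (rule carrierE)
  have "a [^] i = a [^] (i + (n + m) * s)"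
    using assms(1,2) by (simp add: x power_mult algebra_simps)
  then have "(n + m) * s = 0 \<or> r \<le> i"
    using index_le[of "(n + m) * s" i] by blast
  then show ?thesis
    using assms(1) power_add_period[of i n] x index_period(1)
    by (auto simp: power_mult)
qed

text \<open>
  This form is free of the bound on exponents. To recover the bounded form, take bounded
  exponents \<open>i\<close> of \<open>x\<close> and \<open>j\<close> of \<open>y\<close>. They agree modulo \<open>s\<close>, and if \<open>j < i\<close> then \<open>x\<close> is a shift
  of \<open>y\<close> as well, so \<open>x = y\<close> and \<open>i\<close> serves for both.
\<close>

lemma power_le_iff:
  assumes "x \<in> carrier M" "y \<in> carrier M"
  shows "x \<lesssim> y \<longleftrightarrow> (\<exists>n. y = x \<otimes> a [^] (n * s))"
proof
  assume "x \<lesssim> y"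
  then show "\<exists>n. y = x \<otimes> a [^] (n * s)"
    by (auto simp: power_le_def power_mult)
next
  assume "\<exists>n. y = x \<otimes> a [^] (n * s)"
  then obtain n where n: "y = x \<otimes> a [^] (n * s)" ..
  obtain i where i: "i < r + s" "x = a [^] i"
    using assms(1) by (rule exponent_less)
  obtain j where j: "j < r + s" "y = a [^] j"
    using assms(2) by (rule exponent_less)
  have "a [^] j = a [^] (i + n * s)"
    using n i j by (simp add: power_mult)
  then have mods: "j mod s = i mod s"
    by (auto dest: exponent_mod)
  show "x \<lesssim> y"
  proof (cases "i \<le> j")
    case True
    then have "s dvd j - i"
      using mods mod_eq_dvd_iff_nat by blast
    then obtain m where "j - i = m * s"
      by (metis dvdE mult.commute)
    with True have "j = i + m * s" by simp
    with i j show ?thesis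
      unfolding power_le_def by blast
  next
    case False
    then have "s dvd i - j"
      using mods mod_eq_dvd_iff_nat[of j i s] by simp
    then obtain m where "i - j = m * s"
      by (metis dvdE mult.commute)
    with False have "i = j + m * s" by simp
    then have "x = y \<otimes> a [^] (m * s)"
      by (simp add: i j power_mult)
    from shift_antisym[OF n this assms(1)] have "x = y" .
    moreover have "i = i + 0 * s" by simp
    ultimately show ?thesis
      using i unfolding power_le_def by blast
  qed
qed

lemma le_refl: "x \<in> carrier M \<Longrightarrow> x \<lesssim> x"
proof -
  assume x: "x \<in> carrier M"
  then have "x = x \<otimes> a [^] (0 * s)" by simp
  with x show ?thesis
    using power_le_iff by blast
qed

lemma le_closed: "x \<lesssim> y \<Longrightarrow> x \<in> carrier M \<and> y \<in> carrier M"
  by (auto simp: power_le_def)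

lemma le_antisym: "x \<lesssim> y \<Longrightarrow> y \<lesssim> x \<Longrightarrow> x = y"
proof -
  assume le: "x \<lesssim> y" "y \<lesssim> x"
  then have carr: "x \<in> carrier M" "y \<in> carrier M"
    using le_closed by blast+
  with le obtain m n where "y = x \<otimes> a [^] (m * s)" "x = y \<otimes> a [^] (n * s)"
    using power_le_iff by meson
  then show "x = y"
    using carr(1) by (rule shift_antisym)
qed

lemma le_trans:
  assumes "x \<lesssim> y" "y \<lesssim> z"
  shows "x \<lesssim> z"
proof -
  have carr: "x \<in> carrier M" "y \<in> carrier M" "z \<in> carrier M"
    using assms le_closed by blast+
  then obtain m n where "y = x \<otimes> a [^] (m * s)" "z = y \<otimes> a [^] (n * s)"
    using assms power_le_iff by meson
  then have "z = x \<otimes> a [^] ((m + n) * s)"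
    using carr by (simp add: m_assoc power_mult algebra_simps)
  with carr show ?thesis
    using power_le_iff by blast
qed

lemma mult_left_mono:
  assumes "x \<in> carrier M" "y \<lesssim> z"
  shows "x \<otimes> y \<lesssim> x \<otimes> z"
proof -
  have carr: "y \<in> carrier M" "z \<in> carrier M"
    using le_closed[OF assms(2)] by auto
  then obtain n where "z = y \<otimes> a [^] (n * s)"
    using assms(2) power_le_iff by meson
  then have "x \<otimes> z = x \<otimes> y \<otimes> a [^] (n * s)"
    using assms(1) carr by (simp add: m_assoc)
  then show ?thesis
    using assms(1) carr power_le_iff by blast
qed

lemma le_exponent_mod: "a [^] (i::nat) \<lesssim> a [^] (j::nat) \<Longrightarrow> i mod s = j mod s"
proof -
  assume "a [^] i \<lesssim> a [^] j"
  then obtain n where "a [^] j = a [^] (i + n * s)"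
    unfolding power_mult[symmetric] using power_le_iff power_closed by meson
  from exponent_mod[OF this] show "i mod s = j mod s"
    by simp
qed

lemma comparable_if_exponent_mod:
  assumes "i mod s = j mod s"
  shows "a [^] (i::nat) \<lesssim> a [^] (j::nat) \<or> a [^] j \<lesssim> a [^] i"
proof -
  have *: "a [^] i \<lesssim> a [^] j" if le: "i \<le> j" and "i mod s = j mod s" for i j :: nat
  proof -
    have "s dvd j - i"
      using that mod_eq_dvd_iff_nat[of i j s] by simp
    then obtain m where "j - i = m * s"
      by (metis dvdE mult.commute)
    with le have "j = i + m * s" by simp
    then have "a [^] j = a [^] i \<otimes> a [^] (m * s)"
      by (simp add: power_mult)
    then show ?thesis
      using power_le_iff power_closed by blast
  qed
  show ?thesis
    using *[of i j] *[of j i] assms by (metis linear)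
qed

lemma comparable_if_common_lower_bound:
  assumes "z \<lesssim> x" "z \<lesssim> y"
  shows "x \<lesssim> y \<or> y \<lesssim> x"
proof -
  obtain i j k :: nat where "x = a [^] i" "y = a [^] j" "z = a [^] k"
    using assms le_closed by (meson carrierE)
  with assms show ?thesis
    using le_exponent_mod[of k i] le_exponent_mod[of k j] comparable_if_exponent_mod[of i j]
    by simp
qed

text \<open>A form of cancellation: it holds up to comparability although \<open>M\<close> is not cancellative.\<close>

lemma comparable_if_mult_le:
  assumes "x \<in> carrier M" "y \<in> carrier M" "y' \<in> carrier M" "x \<otimes> y \<lesssim> z" "x \<otimes> y' \<lesssim> z"
  shows "y \<lesssim> y' \<or> y' \<lesssim> y"
proof -
  obtain i j j' k :: nat where e: "x = a [^] i" "y = a [^] j" "y' = a [^] j'" "z = a [^] k"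
    using assms le_closed by (meson carrierE)
  have "(i + j) mod s = (i + j') mod s"
    using assms le_exponent_mod[of "i + j" k] le_exponent_mod[of "i + j'" k]
    by (simp add: e power_mult)
  then have "j mod s = j' mod s"
    by (simp add: nat_mod_eq_iff add.assoc)
  then show ?thesis
    using comparable_if_exponent_mod e by simp
qed

lemma comparable_if_common_upper_bound:
  "x \<lesssim> z \<Longrightarrow> y \<lesssim> z \<Longrightarrow> x \<lesssim> y \<or> y \<lesssim> x"
  using comparable_if_mult_le[of \<one> x y z] le_closed[of x z] le_closed[of y z] by simp


section \<open>Adjoining bounds\<close>

abbreviation R :: "'a adjoined set" where "R \<equiv> Elem ` carrier M \<union> {Bot, Top}"

abbreviation adj_le :: "'a adjoined \<Rightarrow> 'a adjoined \<Rightarrow> bool" (infix \<open>\<unlhd>\<close> 50)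
  where "x \<unlhd> y \<equiv> adjoined_le M a x y"

abbreviation adj_mult :: "'a adjoined \<Rightarrow> 'a adjoined \<Rightarrow> 'a adjoined" (infixl \<open>\<odot>\<close> 70)
  where "x \<odot> y \<equiv> adjoined_mult M x y"

lemma adj_le_Bot_iff [simp]: "x \<unlhd> Bot \<longleftrightarrow> x = Bot"
  by (cases x) auto

lemma Top_adj_le_iff [simp]: "Top \<unlhd> x \<longleftrightarrow> x = Top"
  by (cases x) auto

lemma adj_le_Top [simp]: "x \<unlhd> Top"
  by (cases x) auto

lemma adj_mult_Bot [simp]: "x \<odot> Bot = Bot"
  by (cases x) auto

lemma adj_mult_Top [simp]: "x \<noteq> Bot \<Longrightarrow> x \<odot> Top = Top"
  by (cases x) auto

lemma adj_mult_comm: "x \<in> R \<Longrightarrow> y \<in> R \<Longrightarrow> x \<odot> y = y \<odot> x"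
  by (cases x; cases y) (auto simp: mult_comm)

lemma adj_monoid:
  shows "x \<in> R \<Longrightarrow> y \<in> R \<Longrightarrow> x \<odot> y \<in> R"
    and "Elem \<one> \<in> R"
    and "x \<in> R \<Longrightarrow> y \<in> R \<Longrightarrow> z \<in> R \<Longrightarrow> x \<odot> y \<odot> z = x \<odot> (y \<odot> z)"
    and "x \<in> R \<Longrightarrow> Elem \<one> \<odot> x = x"
    and "x \<in> R \<Longrightarrow> x \<odot> Elem \<one> = x"
proof -
  show "x \<in> R \<Longrightarrow> y \<in> R \<Longrightarrow> x \<odot> y \<in> R"
    by (cases x; cases y) auto
  show "x \<in> R \<Longrightarrow> y \<in> R \<Longrightarrow> z \<in> R \<Longrightarrow> x \<odot> y \<odot> z = x \<odot> (y \<odot> z)"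
    by (cases x; cases y; cases z) (auto simp: m_assoc)
  show "Elem \<one> \<in> R" by simp
  show "x \<in> R \<Longrightarrow> Elem \<one> \<odot> x = x" "x \<in> R \<Longrightarrow> x \<odot> Elem \<one> = x"
    by (cases x; auto)+
qed

lemma adj_le_refl: "x \<in> R \<Longrightarrow> x \<unlhd> x"
  by (auto simp: le_refl)

lemma adj_le_antisym: "x \<unlhd> y \<Longrightarrow> y \<unlhd> x \<Longrightarrow> x = y"
  by (cases x; cases y) (auto intro: le_antisym)

lemma adj_le_trans: "x \<unlhd> y \<Longrightarrow> y \<unlhd> z \<Longrightarrow> x \<unlhd> z"
  by (cases x; cases y; cases z) (auto intro: le_trans)

text \<open>
  Two incomparable elements have no common bound in \<open>M\<close>, which leaves only the new bounds.
\<close>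

lemma adj_join_exists:
  assumes "x \<in> R" "y \<in> R"
  shows "\<exists>u\<in>R. x \<unlhd> u \<and> y \<unlhd> u \<and> (\<forall>v\<in>R. x \<unlhd> v \<and> y \<unlhd> v \<longrightarrow> u \<unlhd> v)"
proof (cases "x \<unlhd> y \<or> y \<unlhd> x")
  case True
  with assms show ?thesis by (blast intro: adj_le_refl)
next
  case False
  have "v = Top" if "x \<unlhd> v" "y \<unlhd> v" for v
    using that False comparable_if_common_upper_bound by (cases x; cases y; cases v) auto
  then show ?thesis
    by (intro bexI[of _ Top]) auto
qed

lemma adj_meet_exists:
  assumes "x \<in> R" "y \<in> R"
  shows "\<exists>u\<in>R. u \<unlhd> x \<and> u \<unlhd> y \<and> (\<forall>v\<in>R. v \<unlhd> x \<and> v \<unlhd> y \<longrightarrow> v \<unlhd> u)"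
proof (cases "x \<unlhd> y \<or> y \<unlhd> x")
  case True
  with assms show ?thesis by (blast intro: adj_le_refl)
next
  case False
  have "v = Bot" if "v \<unlhd> x" "v \<unlhd> y" for v
    using that False comparable_if_common_lower_bound by (cases x; cases y; cases v) auto
  then show ?thesis
    by (intro bexI[of _ Bot]) auto
qed

text \<open>
  Solutions in \<open>M\<close> for \<open>x\<close>, \<open>z\<close> in \<open>M\<close> are pairwise comparable, so finiteness of \<open>M\<close> yields a greatest
  one as soon as there is one; \<open>Top\<close> never competes with it, because \<open>x \<odot> Top = Top\<close> is not below \<open>z\<close>.
\<close>

lemma residual_exists:
  assumes "x \<in> R" "z \<in> R"
  shows "\<exists>w\<in>R. \<forall>y\<in>R. x \<odot> y \<unlhd> z \<longleftrightarrow> y \<unlhd> w"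
proof -
  consider "x = Bot \<or> z = Top" | "x \<noteq> Bot" "z = Bot" | "x = Top" "z \<noteq> Top"
    | b c where "x = Elem b" "z = Elem c" "b \<in> carrier M" "c \<in> carrier M"
    using assms by auto
  then show ?thesis
  proof cases
    case 1
    then show ?thesis by (intro bexI[of _ Top]) auto
  next
    case 2
    have "x \<odot> y = Bot \<longleftrightarrow> y = Bot" for y
      using 2 by (cases x; cases y) auto
    with 2 show ?thesis by (intro bexI[of _ Bot]) auto
  next
    case 3
    have "Top \<odot> y \<unlhd> z \<longleftrightarrow> y = Bot" for y
      using 3 by (cases y) auto
    with 3 show ?thesis by (intro bexI[of _ Bot]) auto
  next
    case 4
    define Y where "Y = {y \<in> carrier M. b \<otimes> y \<lesssim> c}"
    show ?thesis
    proof (cases "Y = {}")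
      case True
      have "x \<odot> y \<unlhd> z \<longleftrightarrow> y = Bot" if "y \<in> R" for y
        using 4 True that by (cases y) (auto simp: Y_def)
      then show ?thesis by (intro bexI[of _ Bot]) auto
    next
      case False
      have "finite Y"
        using finite_carrier by (simp add: Y_def)
      moreover have "transp_on Y (\<lesssim>)"
        by (auto intro!: transp_onI intro: le_trans)
      moreover have "totalp_on Y (\<lesssim>)"
        using comparable_if_mult_le[OF 4(3)] by (auto intro!: totalp_onI simp: Y_def)
      ultimately obtain w where w: "w \<in> Y" "\<And>y. y \<in> Y \<Longrightarrow> y \<noteq> w \<Longrightarrow> y \<lesssim> w"
        using Finite_Set.bex_greatest_element[of Y "(\<lesssim>)"] False by blast
      have "b \<otimes> y \<lesssim> c \<longleftrightarrow> y \<lesssim> w" if "y \<in> carrier M" for y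
      proof
        assume "b \<otimes> y \<lesssim> c"
        with that w show "y \<lesssim> w"
          by (cases "y = w") (auto simp: Y_def le_refl)
      next
        assume "y \<lesssim> w"
        then have "b \<otimes> y \<lesssim> b \<otimes> w"
          using 4 by (intro mult_left_mono)
        with w show "b \<otimes> y \<lesssim> c"
          by (auto simp: Y_def intro: le_trans)
      qed
      with 4 have "x \<odot> y \<unlhd> z \<longleftrightarrow> y \<unlhd> Elem w" if "y \<in> R" for y
        using that by (cases y) auto
      then show ?thesis
        using w by (intro bexI[of _ "Elem w"]) (auto simp: Y_def)
    qed
  qed
qed

end


section \<open>The residuated lattice\<close>

theorem theorem6p4:
  fixes M :: "('a, 'b) monoid_scheme" and a :: 'a
  assumes "finite_cyclic_monoid M a"
  shows "\<exists>A :: 'a adjoined residuated_structure. residuated_lattice A \<and> is_reduct_of (R_of M a) A"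
proof -
  interpret finite_cyclic_monoid M a by (fact assms)
  define is_residual where "is_residual x z w \<longleftrightarrow>
      w \<in> R \<and> (\<forall>y\<in>R. x \<odot> y \<unlhd> z \<longleftrightarrow> y \<unlhd> w)" for x z w
  define res where "res x z = (SOME w. is_residual x z w)" for x z
  have "is_residual x z (res x z)" if "x \<in> R" "z \<in> R" for x z
    unfolding res_def
    by (rule someI_ex) (use residual_exists[OF that] in \<open>unfold is_residual_def, blast\<close>)
  then have res_closed: "\<And>x z. x \<in> R \<Longrightarrow> z \<in> R \<Longrightarrow> res x z \<in> R"
    and res: "\<And>x y z. x \<in> R \<Longrightarrow> y \<in> R \<Longrightarrow> z \<in> R \<Longrightarrow>
      x \<odot> y \<unlhd> z \<longleftrightarrow> y \<unlhd> res x z"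
    unfolding is_residual_def by blast+
  define A where "A = \<lparr>carrier = R, mult = adjoined_mult M, one = Elem \<one>\<^bsub>M\<^esub>, mle = adjoined_le M a,
    ldiv = res, rdiv = \<lambda>z y. res y z\<rparr>"
  have A_simps: "carrier A = R" "mult A = adjoined_mult M" "one A = Elem \<one>\<^bsub>M\<^esub>"
    "mle A = adjoined_le M a" "ldiv A = res" "rdiv A = (\<lambda>z y. res y z)"
    by (simp_all add: A_def)
  have order_simps: "carrier (order_of A) = R" "gorder.le (order_of A) = adjoined_le M a"
    "eq (order_of A) = (=)"
    by (simp_all add: order_of_def A_simps)
  have "monoid A"
    by (rule monoidI; unfold A_simps) (assumption | rule adj_monoid)+
  moreover have "lattice (order_of A)"
  proof (unfold_locales; unfold order_simps)
    fix x y assume xy: "x \<in> R" "y \<in> R"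
    from adj_join_exists[OF xy] obtain u where
      "u \<in> R" "x \<unlhd> u" "y \<unlhd> u"
      "\<And>v. v \<in> R \<Longrightarrow> x \<unlhd> v \<Longrightarrow> y \<unlhd> v \<Longrightarrow> u \<unlhd> v"
      by blast
    with xy show "\<exists>u. least (order_of A) u (Upper (order_of A) {x, y})"
      unfolding least_def Upper_def order_simps by (intro exI[of _ u]) blast
    from adj_meet_exists[OF xy] obtain l where
      "l \<in> R" "l \<unlhd> x" "l \<unlhd> y"
      "\<And>v. v \<in> R \<Longrightarrow> v \<unlhd> x \<Longrightarrow> v \<unlhd> y \<Longrightarrow> v \<unlhd> l"
      by blast
    with xy show "\<exists>l. greatest (order_of A) l (Lower (order_of A) {x, y})"
      unfolding greatest_def Lower_def order_simps by (intro exI[of _ l]) blast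
  qed (erule adj_le_refl | (rule adj_le_antisym; assumption) | (rule adj_le_trans; assumption) | simp)+
  moreover have "residuated_lattice_axioms A"
  proof (unfold_locales; unfold A_simps)
    fix x y z assume "x \<in> R" "y \<in> R" "z \<in> R"
    then show "x \<odot> y \<unlhd> z \<longleftrightarrow> x \<unlhd> res y z"
      by (subst adj_mult_comm) (assumption | rule res)+
  qed (assumption | rule res_closed res)+
  ultimately have "residuated_lattice A"
    by (simp add: residuated_lattice_def)
  moreover have "is_reduct_of (R_of M a) A"
    by (simp add: is_reduct_of_def R_of_def A_def ordered_monoid.truncate_def)
  ultimately show ?thesis by blast
qed

end
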